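(* (i) There is an absolute constant $c>0$ such that the following holds. Let $d=d(n)$ be positive integers with $d/\sqrt{n}\to 0$ as $n\to\infty$. Then for all sufficiently large even $n$ there is an $\mathrm{IP}(d)$-free family $\mathcal{A}\subset\binom{[n]}{n/2}$ with $$|\mathcal{A}|\ge c\,\max\Big\{\frac{1}{nd},\frac{d^2}{n^{3/2}}\Big\}\binom{n}{n/2}.$$ (ii) For every $c>0$ there is $c'>0$ such that for every even $n$ for which $d=c\sqrt{n}$ is a positive integer, there is an $\mathrm{IP}(d)$-free family $\mathcal{A}\subset\binom{[n]}{n/2}$ with $|\mathcal{A}|\ge c'\binom{n}{n/2}$.
   Context: A pattern of order $t$ is an element $P\in\{+,-\}^t$. For $A,B\subset[n]$ write $\mathrm{pat}(A,B)=P$ if $A\triangle B=\{j_1,\dots,j_t\}$ with $j_1<\dots<j_t$, $P$ has order $t$, and $\{i\in[t]:P_i=+\}=\{i\in[t]: j_i\in A\setminus B\}$. A family $\mathcal{A}$ of subsets of $[n]$ is $P$-free if $\mathrm{pat}(A,B)\neq P$ for all $A,B\in\mathcal{A}$. The interval pattern $\mathrm{IP}(d)\in\{+,-\}^{2d}$ consists of $d$ plus signs followed by $d$ minus signs. *)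

theory Defs
  imports Complex_Main
begin

datatype sign = Plus | Minus

type_synonym pattern = "sign list"

text \<open>
  The ground set \<open>[n]\<close> is \<open>{1..n}\<close>. The pattern of a pair of finite sets reads off the signs along
  the increasing enumeration of the symmetric difference, so its order is the size of that set.
\<close>

definition pat :: "nat set \<Rightarrow> nat set \<Rightarrow> pattern" where
  "pat A B = map (\<lambda>j. if j \<in> A - B then Plus else Minus) (sorted_list_of_set ((A - B) \<union> (B - A)))"

definition pattern_free :: "pattern \<Rightarrow> nat set set \<Rightarrow> bool" where
  "pattern_free P \<A> \<longleftrightarrow> (\<forall>A\<in>\<A>. \<forall>B\<in>\<A>. pat A B \<noteq> P)"

definition IP :: "nat \<Rightarrow> pattern" where
  "IP d = replicate d Plus @ replicate d Minus"

definition layer :: "nat \<Rightarrow> nat \<Rightarrow> nat set set" where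
  "layer n k = {A. A \<subseteq> {1..n} \<and> card A = k}"

end

theory Submission
  imports Defs "HOL-Analysis.Convex"
begin

text \<open>
  If \<open>pat A B = IP d\<close>, then \<open>A - B\<close> and \<open>B - A\<close> have \<open>d\<close> elements each and the former lies entirely
  below the latter. Two obstructions follow.

  First, \<open>\<Sum>B - \<Sum>A\<close> lies between \<open>d\<^sup>2\<close> and \<open>n d\<close>. Hence
  \<open>(\<Sum>A div d\<^sup>2) mod (n div d + 2)\<close> separates \<open>A\<close> from \<open>B\<close>, and by pigeonhole some class of this
  colouring has density at least \<open>d / (3 n)\<close>, which for \<open>d \<le> \<surd>n\<close> dominates both terms in (i).

  Second, at a point \<open>t\<close> separating \<open>A - B\<close> from \<open>B - A\<close>, the \<open>\<plusminus>1\<close> walks associated with \<open>A\<close> and \<open>B\<close>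
  differ by \<open>2 d\<close>. So the sets whose walk stays strictly between \<open>-d\<close> and \<open>d\<close> form an \<open>IP(d)\<close>-free
  family. Weighting walks of length \<open>n / 2\<close> confined to \<open>(-d/2, d/2)\<close> by the cosine eigenfunction
  shows that there are at least \<open>(2 cos (\<pi>/d))^(n/2)\<close> of them; gluing two walks with the same
  endpoint (the second one reversed in sign) and the Cauchy-Schwarz inequality
  give at least \<open>(2 cos (\<pi>/d))^n / d\<close> admissible sets, a constant proportion when \<open>d = c \<surd>n\<close>.
\<close>

section \<open>Pairs realising the interval pattern\<close>

text \<open>The enumeration splits at the sign change into \<open>us\<close> and \<open>vs\<close>.
  The signs identify these with \<open>A - B\<close> and \<open>B - A\<close>, and sortedness of the
  concatenation gives the separation.\<close>

lemma pat_eq_IP_D: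
  assumes "finite A" "finite B" "pat A B = IP d"
  shows "card (A - B) = d" "card (B - A) = d" "\<And>a b. a \<in> A - B \<Longrightarrow> b \<in> B - A \<Longrightarrow> a < b"
proof -
  define f where "f = (\<lambda>j. if j \<in> A - B then Plus else Minus)"
  define xs where "xs = sorted_list_of_set ((A - B) \<union> (B - A))"
  have "map f xs = replicate d Plus @ replicate d Minus"
    using assms(3) by (simp add: pat_def IP_def f_def xs_def)
  then obtain us vs where xs: "xs = us @ vs" and us: "map f us = replicate d Plus"
    and vs: "map f vs = replicate d Minus"
    by (auto simp: map_eq_append_conv)
  have set_xs: "set xs = (A - B) \<union> (B - A)"
    using assms by (simp add: xs_def)
  have dist: "distinct xs" and sorted: "sorted_wrt (<) xs"
    by (simp_all add: xs_def)
  have "f x = Plus" if "x \<in> set us" for x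
    using that us by (metis image_eqI in_set_replicate list.set_map)
  then have us_sub: "set us \<subseteq> A - B"
    unfolding f_def by (metis sign.distinct(1) subsetI)
  have "f x = Minus" if "x \<in> set vs" for x
    using that vs by (metis image_eqI in_set_replicate list.set_map)
  then have vs_sub: "set vs \<inter> (A - B) = {}"
    unfolding f_def by (metis disjoint_iff sign.distinct(1))
  have set_us: "set us = A - B" and set_vs: "set vs = B - A"
    using us_sub vs_sub set_xs xs by auto
  have "length us = d" "length vs = d"
    using us vs by (metis length_map length_replicate)+
  moreover have "distinct us" "distinct vs"
    using dist xs by auto
  ultimately show "card (A - B) = d" "card (B - A) = d"
    using set_us set_vs distinct_card by metis+
  show "a < b" if "a \<in> A - B" "b \<in> B - A" for a b
    using sorted that set_us set_vs by (simp add: xs sorted_wrt_append)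
qed

text \<open>Measured from \<open>t = Max A\<close>, the deficits \<open>t - a\<close> are
  \<open>d\<close> distinct naturals, and so are the excesses \<open>b - Suc t\<close>. Each family
  sums to at least \<open>0 + ... + (d - 1)\<close>. The extra unit in \<open>Suc t\<close>
  contributes another \<open>d\<close>, for \<open>d (d - 1) + d = d\<^sup>2\<close> in
  total.\<close>

lemma sum_separated_ge:
  fixes A B :: "nat set"
  assumes "finite A" "finite B" "card A = d" "card B = d"
    and less: "\<And>a b. a \<in> A \<Longrightarrow> b \<in> B \<Longrightarrow> a < b"
  shows "\<Sum>A + d\<^sup>2 \<le> \<Sum>B"
proof (cases "A = {}")
  case True
  then show ?thesis using assms by auto
next
  case False
  define t where "t = Max A"
  have t: "t \<in> A" and A_le: "\<And>a. a \<in> A \<Longrightarrow> a \<le> t"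
    using False assms(1) by (simp_all add: t_def)
  have B_gt: "\<And>b. b \<in> B \<Longrightarrow> t < b"
    using less t by blast
  have injA: "inj_on (\<lambda>a. t - a) A"
    by (rule inj_onI) (metis A_le diff_diff_cancel)
  have injB: "inj_on (\<lambda>b. b - Suc t) B"
    by (rule inj_onI) (metis B_gt Suc_leI le_add_diff_inverse)
  have "\<Sum>{0..<d} \<le> (\<Sum>a\<in>A. t - a)"
    using card_sum_le_nat_sum[of "(\<lambda>a. t - a) ` A"] injA assms(3)
    by (simp add: card_image sum.reindex)
  moreover have "(\<Sum>a\<in>A. t - a) + \<Sum>A = d * t"
    using A_le assms(3) by (simp flip: sum.distrib)
  moreover have "\<Sum>{0..<d} \<le> (\<Sum>b\<in>B. b - Suc t)"
    using card_sum_le_nat_sum[of "(\<lambda>b. b - Suc t) ` B"] injB assms(4)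
    by (simp add: card_image sum.reindex)
  moreover have "(\<Sum>b\<in>B. b - Suc t) + d * Suc t = \<Sum>B"
  proof -
    have "(\<Sum>b\<in>B. b - Suc t) + d * Suc t = (\<Sum>b\<in>B. (b - Suc t) + Suc t)"
      using assms(4) by (subst sum.distrib) simp
    also have "\<dots> = \<Sum>B"
      by (intro sum.cong refl le_add_diff_inverse2 Suc_leI B_gt)
    finally show ?thesis .
  qed
  moreover have "2 * \<Sum>{0..<d} + d = d\<^sup>2"
    by (induction d) (auto simp: power2_eq_square)
  ultimately show ?thesis
    by simp
qed

text \<open>The common part \<open>A \<inter> B\<close> cancels, leaving \<open>d\<close> elements
  on each side. Separation gives the lower bound; the upper one holds because elements of
  \<open>B - A\<close> are at most \<open>n\<close>.\<close>

lemma pat_eq_IP_sum_bounds: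
  assumes "A \<subseteq> {1..n}" "B \<subseteq> {1..n}" "pat A B = IP d"
  shows "\<Sum>A + d\<^sup>2 \<le> \<Sum>B" "\<Sum>B \<le> \<Sum>A + n * d"
proof -
  have fin: "finite A" "finite B"
    using assms(1,2) finite_subset by blast+
  note P = pat_eq_IP_D[OF fin assms(3)]
  have A: "\<Sum>A = \<Sum>(A \<inter> B) + \<Sum>(A - B)"
    using fin by (metis sum.Int_Diff)
  have B: "\<Sum>B = \<Sum>(A \<inter> B) + \<Sum>(B - A)"
    using fin by (metis Int_commute sum.Int_Diff)
  have "\<Sum>(A - B) + d\<^sup>2 \<le> \<Sum>(B - A)"
    using P fin by (intro sum_separated_ge) auto
  then show "\<Sum>A + d\<^sup>2 \<le> \<Sum>B"
    using A B by simp
  have "\<Sum>(B - A) \<le> d * n"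
    using sum_bounded_above[of "B - A" "\<lambda>x. x" n] assms(2) P(2) by (auto simp: subset_iff)
  then show "\<Sum>B \<le> \<Sum>A + n * d"
    using A B by (simp add: mult.commute)
qed

text \<open>At \<open>t = Max (A - B)\<close> all of \<open>A - B\<close> has been counted and, by
  separation, nothing of \<open>B - A\<close>.\<close>

lemma pat_eq_IP_prefix_card:
  assumes "A \<subseteq> {1..n}" "B \<subseteq> {1..n}" "pat A B = IP d" "d > 0"
  obtains t where "t \<le> n" "card (A \<inter> {1..t}) = card (B \<inter> {1..t}) + d"
proof -
  have fin: "finite A" "finite B"
    using assms(1,2) finite_subset by blast+
  note P = pat_eq_IP_D[OF fin assms(3)]
  define t where "t = Max (A - B)"
  have ne: "A - B \<noteq> {}"
    using P(1) assms(4) by (metis card.empty less_irrefl)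
  have t: "t \<in> A - B" and le: "\<And>a. a \<in> A - B \<Longrightarrow> a \<le> t"
    using ne fin Max_in[of "A - B"] by (simp_all add: t_def)
  have "A \<inter> {1..t} = (B \<inter> {1..t}) \<union> (A - B)"
    using P(3)[OF t] le assms(1) by fastforce
  then have "card (A \<inter> {1..t}) = card (B \<inter> {1..t}) + d"
    using P(1) fin by (metis (no_types, lifting) DiffD2 IntD1 card_Un_disjoint disjoint_iff
        finite_Diff finite_Int)
  moreover have "t \<le> n"
    using t assms(1) by auto
  ultimately show ?thesis
    using that by blast
qed

lemma pat_refl: "pat A A = []"
  by (simp add: pat_def)

lemma IP_neq_Nil: "d > 0 \<Longrightarrow> IP d \<noteq> []"
  by (simp add: IP_def)

lemma finite_layer: "finite (layer n k)"
  by (rule finite_subset[of _ "Pow {1..n}"]) (auto simp: layer_def)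

lemma card_layer: "card (layer n k) = n choose k"
  using n_subsets[of "{1..n}" k] by (simp add: layer_def)

section \<open>Colouring by the sum of the elements\<close>

text \<open>A pair realising the pattern raises the quotient of the sum by \<open>d\<^sup>2\<close>
  by at least 1 and by less than \<open>q\<close>, so its two residues modulo \<open>q\<close>
  cannot agree.\<close>

lemma IP_free_sum_class:
  fixes d n :: nat
  assumes "d > 0"
  defines "q \<equiv> n div d + 2"
  shows "pattern_free (IP d) {A \<in> layer n k. (\<Sum>A div d\<^sup>2) mod q = r}"
  unfolding pattern_free_def
proof (intro ballI notI)
  fix A B
  assume A: "A \<in> {A \<in> layer n k. (\<Sum>A div d\<^sup>2) mod q = r}"
    and B: "B \<in> {A \<in> layer n k. (\<Sum>A div d\<^sup>2) mod q = r}"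
    and pat: "pat A B = IP d"
  have sub: "A \<subseteq> {1..n}" "B \<subseteq> {1..n}"
    using A B by (auto simp: layer_def)
  define u v where "u = \<Sum>A div d\<^sup>2" and "v = \<Sum>B div d\<^sup>2"
  have d2: "d\<^sup>2 > 0"
    using assms(1) by simp
  have "(\<Sum>A + d\<^sup>2) div d\<^sup>2 \<le> v"
    unfolding v_def using pat_eq_IP_sum_bounds(1)[OF sub pat] by (rule div_le_mono)
  then have uv: "u < v"
    using d2 by (simp add: u_def)
  \<comment> \<open>The 2 in \<open>q\<close> pays for two roundings: that of \<open>n / d\<close>
    here and that of \<open>\<Sum>A / d\<^sup>2\<close> below.\<close>
  have "d * n < d * (d * (n div d + 1))"
    using assms(1) dividend_less_times_div[of d n] by simp
  then have "n * d < d\<^sup>2 * (n div d + 1)"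
    by (simp add: power2_eq_square algebra_simps)
  moreover have "\<Sum>A < d\<^sup>2 * (u + 1)"
    using d2 dividend_less_times_div[of "d\<^sup>2" "\<Sum>A"] by (simp add: u_def)
  ultimately have "\<Sum>B < d\<^sup>2 * (u + q)"
    using pat_eq_IP_sum_bounds(2)[OF sub pat] by (simp add: q_def algebra_simps)
  then have "v < u + q"
    unfolding v_def using d2 by (simp add: less_mult_imp_div_less mult.commute)
  moreover have "u mod q = v mod q"
    using A B by (simp add: u_def v_def)
  then have "q dvd v - u"
    using uv by (metis less_imp_le mod_eq_dvd_iff_nat)
  ultimately show False
    using uv by (auto dest: dvd_imp_le)
qed

text \<open>Pigeonhole over the \<open>q\<close> residue classes, where \<open>d \<le> n\<close>
  gives \<open>q \<le> 3 n / d\<close>.\<close>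

lemma IP_free_large_sum_class:
  assumes "0 < d" "d \<le> n"
  obtains \<A> where "\<A> \<subseteq> layer n k" "pattern_free (IP d) \<A>"
    "real (card \<A>) \<ge> real d / (3 * real n) * real (n choose k)"
proof -
  define q where "q = n div d + 2"
  define f where "f = (\<lambda>A. (\<Sum>A div d\<^sup>2) mod q)"
  have "f \<in> layer n k \<rightarrow> {..<q}"
    by (auto simp: f_def q_def)
  then obtain r where r: "card (layer n k) \<le> card (f -` {r} \<inter> layer n k) * card {..<q}"
    using pigeonhole_card[of f "layer n k" "{..<q}"] finite_layer[of n k]
    by (auto simp: q_def lessThan_empty_iff)
  define \<A> where "\<A> = {A \<in> layer n k. f A = r}"
  have "f -` {r} \<inter> layer n k = \<A>"
    by (auto simp: \<A>_def)
  then have "n choose k \<le> card \<A> * q"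
    using r by (simp add: card_layer)
  then have "real (n choose k) \<le> real (card \<A>) * real q"
    by (metis of_nat_le_iff of_nat_mult)
  also have "real q \<le> 3 * real n / real d"
  proof -
    have "q * d = n div d * d + 2 * d"
      by (simp add: q_def algebra_simps)
    also have "\<dots> \<le> 3 * n"
      using assms(2) div_times_less_eq_dividend[of n d] by linarith
    finally have "real q * real d \<le> 3 * real n"
      by (metis of_nat_le_iff of_nat_mult of_nat_numeral)
    then show ?thesis
      using assms(1) by (simp add: field_simps)
  qed
  finally have "real (n choose k) \<le> real (card \<A>) * (3 * real n / real d)"
    by (simp add: mult_left_mono)
  then have "real (card \<A>) \<ge> real d / (3 * real n) * real (n choose k)"
    using assms by (simp add: field_simps)
  moreover have "pattern_free (IP d) \<A>"
    unfolding \<A>_def f_def q_def by (rule IP_free_sum_class[OF assms(1)])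
  ultimately show ?thesis
    using that[of \<A>] by (auto simp: \<A>_def)
qed

section \<open>Walks confined to a strip\<close>

text \<open>Position at time \<open>t\<close> of the walk that steps up at elements of
  \<open>A\<close> and down elsewhere.\<close>

definition height :: "nat set \<Rightarrow> nat \<Rightarrow> int" where
  "height A t = 2 * int (card (A \<inter> {1..t})) - int t"

text \<open>The half-width is \<open>d / 2\<close>, doubled to stay in the integers. A difference of
  two such heights is then below \<open>d\<close>, which is what gluing needs.\<close>

definition confined :: "nat \<Rightarrow> nat \<Rightarrow> nat set set" where
  "confined d n = {A. A \<subseteq> {1..n} \<and> (\<forall>t\<le>n. 2 * \<bar>height A t\<bar> < int d)}"

lemma finite_confined: "finite (confined d n)"
  by (rule finite_subset[of _ "Pow {1..n}"]) (auto simp: confined_def)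

lemma confined_0: "d > 0 \<Longrightarrow> confined d 0 = {{}}"
  by (auto simp: confined_def height_def)

lemma height_Suc:
  "height A (Suc n) = (if Suc n \<in> A then height A n + 1 else height A n - 1)"
  by (simp add: height_def atLeastAtMostSuc_conv)

lemma height_insert: "t < m \<Longrightarrow> height (insert m A) t = height A t"
  by (simp add: height_def)

lemma cos_add_cos_shift: "cos (x - y) + cos (x + y) = 2 * cos y * cos (x :: real)"
  by (simp add: cos_add cos_diff)

text \<open>Meant for walks that have just left the strip: \<open>\<pi> \<bar>x\<bar> / d\<close>
  lies between \<open>\<pi> / 2\<close> and \<open>3 \<pi> / 2\<close>.\<close>

lemma cos_nonpos_outside:
  fixes x :: int
  assumes "d > 0" "int d \<le> 2 * \<bar>x\<bar>" "2 * \<bar>x\<bar> \<le> 3 * int d"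
  shows "cos (pi / real d * real_of_int x) \<le> 0"
proof -
  define y where "y = pi / real d * real_of_int \<bar>x\<bar>"
  have "real d \<le> 2 * real_of_int \<bar>x\<bar>" "2 * real_of_int \<bar>x\<bar> \<le> 3 * real d"
    using assms(2,3) by linarith+
  then have "pi * real d \<le> pi * (2 * real_of_int \<bar>x\<bar>)" "pi * (2 * real_of_int \<bar>x\<bar>) \<le> pi * (3 * real d)"
    by (simp_all only: mult_left_mono pi_ge_zero)
  then have "pi / 2 \<le> y" "y \<le> 3 * pi / 2"
    using assms(1) by (simp_all add: y_def field_simps)
  then have "cos (y - pi) \<ge> 0"
    by (intro cos_ge_zero) linarith+
  moreover have "cos (pi / real d * real_of_int x) = cos y"
    by (simp add: y_def abs_if)
  ultimately show ?thesis
    by simp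
qed

text \<open>Stepping both ways multiplies the weight \<open>cos (\<pi> x / d)\<close> by
  \<open>2 cos (\<pi> / d)\<close>. Extensions that leave the strip have non-positive weight, so
  dropping them cannot lower the sum.\<close>

lemma cos_sum_confined_ge:
  assumes "d \<ge> 2"
  shows "(2 * cos (pi / real d)) ^ n \<le> (\<Sum>A\<in>confined d n. cos (pi / real d * real_of_int (height A n)))"
proof (induction n)
  case 0
  then show ?case
    using assms by (simp add: confined_0 height_def)
next
  case (Suc n)
  define \<phi> where "\<phi> = (\<lambda>x::int. cos (pi / real d * real_of_int x))"
  \<comment> \<open>\<open>E\<close> collects both one-step extensions of every confined walk,
    including those that leave the strip.\<close>
  define E where "E = confined d n \<union> insert (Suc n) ` confined d n"
  have notin: "Suc n \<notin> A" if "A \<in> confined d n" for A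
    using that by (auto simp: confined_def)
  have \<phi>_shift: "\<phi> (x - 1) + \<phi> (x + 1) = 2 * cos (pi / real d) * \<phi> x" for x
    using cos_add_cos_shift[of "pi / real d * real_of_int x" "pi / real d"]
    by (simp add: \<phi>_def algebra_simps add_divide_distrib diff_divide_distrib)
  have cos_nonneg: "0 \<le> cos (pi / real d)"
    using assms by (intro cos_ge_zero) (simp_all add: field_simps order_trans[of _ 0])
  have fin: "finite E"
    by (simp add: E_def finite_confined)
  have sub: "confined d (Suc n) \<subseteq> E"
  proof
    fix C assume C: "C \<in> confined d (Suc n)"
    define A where "A = C - {Suc n}"
    have "height A t = height C t" if "t \<le> n" for t
    proof -
      have "A \<inter> {1..t} = C \<inter> {1..t}"
        using that by (auto simp: A_def)
      then show ?thesis
        by (simp add: height_def)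
    qed
    moreover have "A \<subseteq> {1..n}"
      using C by (auto simp: A_def confined_def le_Suc_eq subset_iff)
    ultimately have "A \<in> confined d n"
      using C by (simp add: confined_def)
    moreover have "C = A \<or> C = insert (Suc n) A"
      by (auto simp: A_def)
    ultimately show "C \<in> E"
      by (auto simp: E_def)
  qed
  have outside: "\<phi> (height C (Suc n)) \<le> 0" if C: "C \<in> E - confined d (Suc n)" for C
  proof -
    obtain A where A: "A \<in> confined d n" "C = A \<or> C = insert (Suc n) A"
      using C by (auto simp: E_def)
    have same: "height C t = height A t" if "t \<le> n" for t
      using A that by (auto simp: height_insert)
    have small: "2 * \<bar>height C t\<bar> < int d" if "t \<le> n" for t
      using A that by (simp add: same confined_def)
    have "C \<subseteq> {1..Suc n}"
      using A by (auto simp: confined_def)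
    then obtain t where "t \<le> Suc n" "\<not> 2 * \<bar>height C t\<bar> < int d"
      using C by (auto simp: confined_def)
    then have "int d \<le> 2 * \<bar>height C (Suc n)\<bar>"
      using small le_Suc_eq by (metis linorder_not_le)
    \<comment> \<open>The last step changes the height by 1, so twice its modulus is below
      \<open>d + 2 \<le> 3 d\<close>.\<close>
    moreover have "2 * \<bar>height C (Suc n)\<bar> \<le> 3 * int d"
      using small[of n] assms by (auto simp: height_Suc abs_if split: if_splits)
    ultimately show ?thesis
      unfolding \<phi>_def using assms by (intro cos_nonpos_outside) auto
  qed
  have inj: "inj_on (insert (Suc n)) (confined d n)"
    by (rule inj_onI) (metis insert_ident notin)
  have "(2 * cos (pi / real d)) ^ Suc n \<le> 2 * cos (pi / real d) * (\<Sum>A\<in>confined d n. \<phi> (height A n))"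
    using Suc cos_nonneg by (simp add: \<phi>_def mult_left_mono)
  also have "\<dots> = (\<Sum>A\<in>confined d n. \<phi> (height A n - 1) + \<phi> (height A n + 1))"
    by (simp add: \<phi>_shift sum_distrib_left)
  also have "\<dots> = (\<Sum>A\<in>confined d n. \<phi> (height A (Suc n))) +
                  (\<Sum>A\<in>confined d n. \<phi> (height (insert (Suc n) A) (Suc n)))"
    by (simp add: sum.distrib height_Suc height_insert notin)
  also have "\<dots> = (\<Sum>C\<in>E. \<phi> (height C (Suc n)))"
    unfolding E_def using notin inj
    by (subst sum.union_disjoint) (auto simp: finite_confined sum.reindex)
  also have "\<dots> = (\<Sum>C\<in>E - confined d (Suc n). \<phi> (height C (Suc n))) +
                  (\<Sum>C\<in>confined d (Suc n). \<phi> (height C (Suc n)))"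
    using sub fin by (rule sum.subset_diff)
  also have "\<dots> \<le> (\<Sum>C\<in>confined d (Suc n). \<phi> (height C (Suc n)))"
    using sum_nonpos[of "E - confined d (Suc n)" "\<lambda>C. \<phi> (height C (Suc n))", OF outside] by linarith
  finally show ?case
    by (simp add: \<phi>_def)
qed

text \<open>Each cosine weight is at most 1.\<close>

lemma card_confined_ge:
  assumes "d \<ge> 2"
  shows "(2 * cos (pi / real d)) ^ n \<le> real (card (confined d n))"
proof -
  have "(\<Sum>A\<in>confined d n. cos (pi / real d * real_of_int (height A n))) \<le> (\<Sum>A\<in>confined d n. 1)"
    by (intro sum_mono) simp
  then show ?thesis
    using cos_sum_confined_ge[OF assms, of n] by simp
qed

section \<open>Gluing two confined walks\<close>

text \<open>Complementing \<open>B\<close> negates its steps, so from the endpoint of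
  \<open>A\<close> the walk continues with the negated walk of \<open>B\<close>.\<close>

definition glue :: "nat \<Rightarrow> nat set \<Rightarrow> nat set \<Rightarrow> nat set" where
  "glue k A B = A \<union> (+) k ` ({1..k} - B)"

text \<open>The second and third items recover \<open>A\<close> and \<open>B\<close> from the glued
  set, which makes gluing injective.\<close>

lemma glue_props:
  assumes "A \<subseteq> {1..k}" "B \<subseteq> {1..k}"
  shows "glue k A B \<subseteq> {1..2 * k}" "glue k A B \<inter> {1..k} = A"
    "{j \<in> {1..k}. k + j \<notin> glue k A B} = B"
    "t \<le> k \<Longrightarrow> height (glue k A B) t = height A t"
    "j \<le> k \<Longrightarrow> height (glue k A B) (k + j) = height A k - height B j"
proof -
  show "glue k A B \<subseteq> {1..2 * k}" "glue k A B \<inter> {1..k} = A"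
    "{j \<in> {1..k}. k + j \<notin> glue k A B} = B"
    using assms by (fastforce simp: glue_def)+
  show "height (glue k A B) t = height A t" if "t \<le> k"
  proof -
    have "glue k A B \<inter> {1..t} = A \<inter> {1..t}"
      using that by (auto simp: glue_def)
    then show ?thesis
      by (simp add: height_def)
  qed
  show "height (glue k A B) (k + j) = height A k - height B j" if "j \<le> k"
  proof -
    have "glue k A B \<inter> {1..k + j} = (A \<inter> {1..k}) \<union> (+) k ` ({1..j} - B)"
      using that assms by (auto simp: glue_def)
    moreover have "card ((A \<inter> {1..k}) \<union> (+) k ` ({1..j} - B)) =
        card (A \<inter> {1..k}) + card ((+) k ` ({1..j} - B))"
      by (rule card_Un_disjoint) auto
    moreover have "card ((+) k ` ({1..j} - B)) = card ({1..j} - B)"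
      by (simp add: card_image)
    moreover have "card ({1..j} - B) + card (B \<inter> {1..j}) = j"
      using card_Diff_subset_Int[of "{1..j}" B] card_mono[of "{1..j}" "B \<inter> {1..j}"]
      by (simp add: Int_commute)
    ultimately show ?thesis
      by (simp add: height_def)
  qed
qed

lemma height_glue_bound:
  assumes "A \<in> confined d k" "B \<in> confined d k" "t \<le> 2 * k"
  shows "\<bar>height (glue k A B) t\<bar> < int d"
proof -
  have AB: "A \<subseteq> {1..k}" "B \<subseteq> {1..k}" and
    A: "\<And>t. t \<le> k \<Longrightarrow> 2 * \<bar>height A t\<bar> < int d" and
    B: "\<And>t. t \<le> k \<Longrightarrow> 2 * \<bar>height B t\<bar> < int d"
    using assms by (auto simp: confined_def)
  show ?thesis
  proof (cases "t \<le> k")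
    case True
    then show ?thesis
      using A[of t] glue_props(4)[OF AB] by auto
  next
    case False
    then obtain j where j: "t = k + j" "j \<le> k"
      using assms(3) by (metis add_le_cancel_left le_add_diff_inverse mult_2 nat_le_linear)
    then show ?thesis
      using A[of k] B[of j] glue_props(5)[OF AB, of j] by auto
  qed
qed

text \<open>Where the prefix counts differ by \<open>d\<close>, the heights differ by
  \<open>2 d\<close>, too far apart for both to lie strictly between \<open>-d\<close> and
  \<open>d\<close>.\<close>

lemma IP_free_bounded_height:
  assumes "d > 0" "\<And>A. A \<in> \<A> \<Longrightarrow> A \<subseteq> {1..n}"
    and "\<And>A t. A \<in> \<A> \<Longrightarrow> t \<le> n \<Longrightarrow> \<bar>height A t\<bar> < int d"
  shows "pattern_free (IP d) \<A>"
  unfolding pattern_free_def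
proof (intro ballI notI)
  fix A B assume AB: "A \<in> \<A>" "B \<in> \<A>" and pat: "pat A B = IP d"
  obtain t where t: "t \<le> n" "card (A \<inter> {1..t}) = card (B \<inter> {1..t}) + d"
    using pat_eq_IP_prefix_card[OF _ _ pat assms(1)] assms(2) AB by metis
  then have "height A t = height B t + 2 * int d"
    by (simp add: height_def)
  then show False
    using assms(3)[OF AB(1) t(1)] assms(3)[OF AB(2) t(1)] by linarith
qed

text \<open>Bounds the number of endpoints, since \<open>card A\<close> determines the final height:
  \<open>4 * card A\<close> lies within \<open>d\<close> of \<open>2 k\<close>.\<close>

lemma card_image_confined_le:
  assumes "d \<ge> 2"
  shows "card (card ` confined d k) \<le> d"
proof -
  \<comment> \<open>The subtraction truncates to 0 when \<open>d > 2 k\<close>. Rounding in the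
    division leaves \<open>j < m + 1 + d / 2\<close>, which is at most \<open>m + d\<close> because
    \<open>d \<ge> 2\<close>.\<close>
  define m where "m = (2 * k - d) div 4"
  have "card ` confined d k \<subseteq> {m..<m + d}"
  proof
    fix j assume "j \<in> card ` confined d k"
    then obtain A where A: "A \<in> confined d k" "j = card A"
      by auto
    then have "A \<inter> {1..k} = A" and "2 * \<bar>height A k\<bar> < int d"
      by (auto simp: confined_def)
    then have "2 * \<bar>2 * int j - int k\<bar> < int d"
      by (simp add: height_def A(2))
    then have "2 * k < 4 * j + d" "4 * j < 2 * k + d"
      by (auto simp: abs_if split: if_splits)
    moreover have "4 * m \<le> 2 * k - d" "2 * k - d < 4 * m + 4"
      unfolding m_def by linarith+
    ultimately have "m \<le> j" "j < m + d"
      using assms by linarith+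
    then show "j \<in> {m..<m + d}"
      by simp
  qed
  then have "card (card ` confined d k) \<le> card {m..<m + d}"
    by (intro card_mono) auto
  then show ?thesis
    by simp
qed

text \<open>Cauchy-Schwarz over the fibres of \<open>f\<close>: their sizes add up to
  \<open>card S\<close>, and the squares of their sizes to the number of pairs.\<close>

lemma square_card_le_card_kernel:
  fixes f :: "'a \<Rightarrow> 'b"
  assumes "finite S"
  shows "(real (card S))\<^sup>2 \<le>
    real (card (f ` S)) * real (card {(x, y). x \<in> S \<and> y \<in> S \<and> f x = f y})"
proof -
  define F where "F = (\<lambda>v. {x \<in> S. f x = v})"
  have finF: "finite (F v)" for v
    using assms by (simp add: F_def)
  have "{(x, y). x \<in> S \<and> y \<in> S \<and> f x = f y} = (\<Union>v\<in>f ` S. F v \<times> F v)"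
    by (auto simp: F_def)
  also have "card \<dots> = (\<Sum>v\<in>f ` S. card (F v \<times> F v))"
    using assms finF by (intro card_UN_disjoint) (auto simp: F_def)
  finally have ker: "real (card {(x, y). x \<in> S \<and> y \<in> S \<and> f x = f y}) = (\<Sum>v\<in>f ` S. (real (card (F v)))\<^sup>2)"
    by (simp add: card_cartesian_product power2_eq_square)
  have "S = (\<Union>v\<in>f ` S. F v)"
    by (auto simp: F_def)
  then have "card S = card (\<Union>v\<in>f ` S. F v)"
    by (rule arg_cong)
  also have "\<dots> = (\<Sum>v\<in>f ` S. card (F v))"
    using assms finF by (intro card_UN_disjoint) (auto simp: F_def)
  finally have "real (card S) = (\<Sum>v\<in>f ` S. real (card (F v)))"
    by simp
  then show ?thesis
    using sum_squared_le_sum_of_squares[of "\<lambda>v. real (card (F v))" "f ` S"] ker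
    by (simp add: mult.commute)
qed

text \<open>Equal cardinality means equal endpoint, so the glued walk returns to 0 at time
  \<open>2 k\<close> and the set has size \<open>k\<close>. Squaring the walk count and dividing by
  the at most \<open>d\<close> endpoints bounds the number of pairs from below.\<close>

lemma IP_free_glued_family:
  assumes "d \<ge> 2"
  obtains \<A> where "\<A> \<subseteq> layer (2 * k) k" "pattern_free (IP d) \<A>"
    "real (card \<A>) \<ge> (2 * cos (pi / real d)) ^ (2 * k) / real d"
proof -
  define S where "S = confined d k"
  define K where "K = {(A, B). A \<in> S \<and> B \<in> S \<and> card A = card B}"
  define \<A> where "\<A> = case_prod (glue k) ` K"
  have S_sub: "A \<subseteq> {1..k}" if "A \<in> S" for A
    using that by (simp add: S_def confined_def)
  have sub: "\<A> \<subseteq> layer (2 * k) k"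
  proof
    fix C assume "C \<in> \<A>"
    then obtain A B where AB: "A \<in> S" "B \<in> S" "card A = card B" "C = glue k A B"
      by (auto simp: \<A>_def K_def)
    have C_sub: "C \<subseteq> {1..2 * k}"
      using AB S_sub glue_props(1) by simp
    have "A \<inter> {1..k} = A" "B \<inter> {1..k} = B"
      using AB S_sub by blast+
    then have "height C (k + k) = 0"
      using AB S_sub glue_props(5)[of A k B k] by (simp add: height_def)
    moreover have "C \<inter> {1..k + k} = C"
      using C_sub by (auto simp: mult_2)
    ultimately have "card C = k"
      by (simp add: height_def)
    then show "C \<in> layer (2 * k) k"
      using C_sub by (simp add: layer_def)
  qed
  have "inj_on (case_prod (glue k)) K"
    by (rule inj_onI) (auto simp: K_def, (metis S_sub glue_props(2,3))+)
  then have card_A: "card \<A> = card K"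
    by (simp add: \<A>_def card_image)
  have free: "pattern_free (IP d) \<A>"
  proof (rule IP_free_bounded_height[of d _ "2 * k"])
    show "\<bar>height C t\<bar> < int d" if "C \<in> \<A>" "t \<le> 2 * k" for C t
      using that height_glue_bound by (auto simp: \<A>_def K_def S_def)
  qed (use assms sub in \<open>auto simp: layer_def\<close>)
  have cos_nonneg: "0 \<le> cos (pi / real d)"
    using assms by (intro cos_ge_zero) (simp_all add: field_simps order_trans[of _ 0])
  have "(2 * cos (pi / real d)) ^ (2 * k) = ((2 * cos (pi / real d)) ^ k)\<^sup>2"
    by (simp only: mult.commute[of 2] power_mult)
  also have "\<dots> \<le> (real (card S))\<^sup>2"
    unfolding S_def using cos_nonneg by (intro power_mono card_confined_ge assms) simp
  also have "\<dots> \<le> real (card (card ` S)) * real (card K)"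
    unfolding K_def by (rule square_card_le_card_kernel) (simp add: S_def finite_confined)
  also have "\<dots> \<le> real d * real (card \<A>)"
    using card_image_confined_le[OF assms, of k] by (simp add: card_A S_def mult_right_mono)
  finally have "(2 * cos (pi / real d)) ^ (2 * k) / real d \<le> real (card \<A>)"
    using assms by (simp add: field_simps)
  then show ?thesis
    using that sub free by blast
qed

section \<open>Comparison with the middle binomial coefficient\<close>

lemma central_binomial_Suc: "Suc k * (2 * Suc k choose Suc k) = 2 * (2 * k + 1) * (2 * k choose k)"
proof -
  have 1: "Suc k * (Suc (2 * k) choose Suc k) = Suc (2 * k) * (2 * k choose k)"
    by (rule Suc_times_binomial)
  have "Suc k * (2 * Suc k choose Suc k) = Suc (Suc (2 * k)) * (Suc (2 * k) choose k)"
    using Suc_times_binomial[of k "Suc (2 * k)"] by simp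
  also have "(Suc (2 * k) choose k) = (Suc (2 * k) choose Suc k)"
    using binomial_symmetric[of k "Suc (2 * k)"] by simp
  also have "Suc (Suc (2 * k)) * (Suc (2 * k) choose Suc k) = 2 * (Suc k * (Suc (2 * k) choose Suc k))"
    by simp
  finally show ?thesis
    unfolding 1 by simp
qed

text \<open>This is the bound \<open>4^k / sqrt (2 k + 1)\<close>, squared to avoid roots. The
  inductive step rests on \<open>(2 k + 1) (2 k + 3) \<le> (2 k + 2)\<^sup>2\<close>.\<close>

lemma central_binomial_upper_bound: "(real (2 * k choose k))\<^sup>2 * (2 * real k + 1) \<le> 16 ^ k"
proof (induction k)
  case 0
  then show ?case by simp
next
  case (Suc k)
  define b b' where "b = real (2 * k choose k)" and "b' = real (2 * Suc k choose Suc k)"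
  have rec: "(real k + 1) * b' = 2 * (2 * real k + 1) * b"
    using arg_cong[OF central_binomial_Suc[of k], of real] unfolding b_def b'_def of_nat_mult
    by (simp add: add.commute)
  have "(real k + 1)\<^sup>2 * (b'\<^sup>2 * (2 * real k + 3)) = ((real k + 1) * b')\<^sup>2 * (2 * real k + 3)"
    by (simp add: power_mult_distrib)
  also have "\<dots> = (b\<^sup>2 * (2 * real k + 1)) * (4 * ((2 * real k + 1) * (2 * real k + 3)))"
    unfolding rec by (simp add: power_mult_distrib power2_eq_square algebra_simps)
  also have "\<dots> \<le> 16 ^ k * (4 * (4 * (real k + 1)\<^sup>2))"
  proof (rule mult_mono)
    show "b\<^sup>2 * (2 * real k + 1) \<le> 16 ^ k"
      using Suc by (simp add: b_def)
    show "4 * ((2 * real k + 1) * (2 * real k + 3)) \<le> 4 * (4 * (real k + 1)\<^sup>2)"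
      by (simp add: power2_eq_square algebra_simps)
  qed auto
  also have "\<dots> = (real k + 1)\<^sup>2 * 16 ^ Suc k"
    by simp
  finally have "b'\<^sup>2 * (2 * real k + 3) \<le> 16 ^ Suc k"
    by (rule mult_left_le_imp_le) auto
  then show ?case
    by (simp add: b'_def algebra_simps)
qed

lemma central_binomial_sqrt_bound: "real (2 * k choose k) * sqrt (real (2 * k)) \<le> 2 ^ (2 * k)"
proof (rule power2_le_imp_le)
  have "(real (2 * k choose k) * sqrt (real (2 * k)))\<^sup>2 = (real (2 * k choose k))\<^sup>2 * (2 * real k)"
    by (simp add: power_mult_distrib)
  also have "\<dots> \<le> (real (2 * k choose k))\<^sup>2 * (2 * real k + 1)"
    by (intro mult_left_mono) auto
  also have "\<dots> \<le> 16 ^ k"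
    by (rule central_binomial_upper_bound)
  also have "\<dots> = (2 ^ (2 * k))\<^sup>2"
    using power_mult[of "2::real" 4 k] by (simp flip: power_mult)
  finally show "(real (2 * k choose k) * sqrt (real (2 * k)))\<^sup>2 \<le> (2 ^ (2 * k))\<^sup>2" .
qed simp

section \<open>Families of constant density at scale \<open>d = c sqrt n\<close>\<close>

text \<open>With \<open>y = x\<^sup>2 / 2 \<le> 1 / 2\<close>, the half-angle formula gives
  \<open>cos x \<ge> 1 - y\<close>, and
  \<open>ln (1 - y) \<ge> - y - 2 y\<^sup>2 \<ge> - 2 y\<close>.\<close>

lemma exp_neg_square_le_cos:
  fixes x :: real
  assumes "\<bar>x\<bar> \<le> 1"
  shows "exp (- x\<^sup>2) \<le> cos x"
proof -
  define y where "y = x\<^sup>2 / 2"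
  have "x\<^sup>2 \<le> 1"
    using assms by (simp add: abs_square_le_1)
  then have y: "0 \<le> y" "y \<le> 1 / 2"
    by (simp_all add: y_def)
  have "2 * y\<^sup>2 \<le> y"
    using mult_left_mono[OF y(2) y(1)] by (simp add: power2_eq_square)
  then have "- x\<^sup>2 \<le> ln (1 - y)"
    using ln_one_minus_pos_lower_bound[OF y] by (simp add: y_def)
  then have "exp (- x\<^sup>2) \<le> exp (ln (1 - y))"
    by simp
  also have "\<dots> = 1 - y"
    using y by simp
  also have "\<dots> \<le> 1 - 2 * (sin (x / 2))\<^sup>2"
  proof -
    have "(sin (x / 2))\<^sup>2 \<le> (x / 2)\<^sup>2"
      using abs_sin_x_le_abs_x[of "x / 2"] by (simp only: abs_le_square_iff)
    then show ?thesis
      by (simp add: y_def power_divide)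
  qed
  also have "\<dots> = cos x"
    using cos_double_sin[of "x / 2"] by simp
  finally show ?thesis .
qed

text \<open>For \<open>n = 2 k\<close> one has
  \<open>n (\<pi> / d)\<^sup>2 = \<pi>\<^sup>2 / c\<^sup>2\<close>, which bounds
  \<open>cos (\<pi> / d) ^ n\<close> below by the exponential. The factor \<open>sqrt n\<close> by
  which \<open>2 ^ n\<close> exceeds the binomial cancels against \<open>d\<close>, leaving
  \<open>1 / c\<close>.\<close>

lemma IP_free_family_sqrt_scale:
  fixes c :: real
  assumes "c > 0" "d \<ge> 4" "real d = c * sqrt (real (2 * k))"
  obtains \<A> where "\<A> \<subseteq> layer (2 * k) k" "pattern_free (IP d) \<A>"
    "real (card \<A>) \<ge> exp (- pi\<^sup>2 / c\<^sup>2) / c * real (2 * k choose k)"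
proof -
  obtain \<A> where A: "\<A> \<subseteq> layer (2 * k) k" "pattern_free (IP d) \<A>"
    and card_A: "real (card \<A>) \<ge> (2 * cos (pi / real d)) ^ (2 * k) / real d"
    using IP_free_glued_family[of d k] assms(2) by auto
  define s where "s = sqrt (real (2 * k))"
  have s: "s > 0" "s\<^sup>2 = real (2 * k)" "real d = c * s"
    using assms unfolding s_def by (auto intro: gr0I)
  have x: "\<bar>pi / real d\<bar> \<le> 1"
    using assms(2) pi_less_4 by simp
  have "real (2 * k) * (pi / real d)\<^sup>2 = pi\<^sup>2 / c\<^sup>2"
    using s(1) unfolding s(3) s(2)[symmetric] by (simp add: power_divide power_mult_distrib)
  then have "exp (- pi\<^sup>2 / c\<^sup>2) = exp (- (pi / real d)\<^sup>2) ^ (2 * k)"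
    by (simp flip: exp_of_nat_mult)
  also have "\<dots> \<le> cos (pi / real d) ^ (2 * k)"
    by (intro power_mono exp_neg_square_le_cos x) simp
  finally have e: "exp (- pi\<^sup>2 / c\<^sup>2) \<le> cos (pi / real d) ^ (2 * k)" .
  have "exp (- pi\<^sup>2 / c\<^sup>2) * (real (2 * k choose k) * s) \<le> cos (pi / real d) ^ (2 * k) * 2 ^ (2 * k)"
    using central_binomial_sqrt_bound[of k] e s(1) by (intro mult_mono) (auto simp: s_def power_mult)
  also have "\<dots> = (2 * cos (pi / real d)) ^ (2 * k)"
    by (simp add: power_mult_distrib mult.commute)
  also have "\<dots> \<le> real (card \<A>) * (c * s)"
    using card_A assms(2) by (simp add: field_simps flip: s(3))
  finally have "exp (- pi\<^sup>2 / c\<^sup>2) / c * real (2 * k choose k) \<le> real (card \<A>)"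
    using s(1) assms(1) by (simp add: field_simps)
  then show ?thesis
    using that A by blast
qed

section \<open>Choice of constants and the two regimes of \<open>d\<close>\<close>

theorem theorem4:
  "(\<exists>c::real. c > 0 \<and>
      (\<forall>d :: nat \<Rightarrow> nat. (\<forall>n. d n > 0) \<longrightarrow>
         (\<lambda>n. real (d n) / sqrt (real n)) \<longlonglongrightarrow> 0 \<longrightarrow>
         (\<forall>\<^sub>F n in sequentially. even n \<longrightarrow>
            (\<exists>\<A>. \<A> \<subseteq> layer n (n div 2) \<and> pattern_free (IP (d n)) \<A> \<and>
               real (card \<A>) \<ge>
                 c * max (1 / (real n * real (d n))) (real (d n) ^ 2 / real n powr (3 / 2))
                   * real (n choose (n div 2)))))) \<and>
   (\<forall>c::real. c > 0 \<longrightarrow>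
      (\<exists>c'::real. c' > 0 \<and>
         (\<forall>n d :: nat. even n \<longrightarrow> d > 0 \<longrightarrow> real d = c * sqrt (real n) \<longrightarrow>
            (\<exists>\<A>. \<A> \<subseteq> layer n (n div 2) \<and> pattern_free (IP d) \<A> \<and>
               real (card \<A>) \<ge> c' * real (n choose (n div 2))))))"
proof (intro conjI allI impI)
  show "\<exists>c::real. c > 0 \<and>
      (\<forall>d :: nat \<Rightarrow> nat. (\<forall>n. d n > 0) \<longrightarrow>
         (\<lambda>n. real (d n) / sqrt (real n)) \<longlonglongrightarrow> 0 \<longrightarrow>
         (\<forall>\<^sub>F n in sequentially. even n \<longrightarrow>
            (\<exists>\<A>. \<A> \<subseteq> layer n (n div 2) \<and> pattern_free (IP (d n)) \<A> \<and>
               real (card \<A>) \<ge>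
                 c * max (1 / (real n * real (d n))) (real (d n) ^ 2 / real n powr (3 / 2))
                   * real (n choose (n div 2)))))"
  \<comment> \<open>The constant comes from the density \<open>d / (3 n)\<close> of the largest sum
    class.\<close>
  proof (intro exI[of _ "1 / 3"] conjI allI impI)
    fix d :: "nat \<Rightarrow> nat"
    assume pos: "\<forall>n. d n > 0" and lim: "(\<lambda>n. real (d n) / sqrt (real n)) \<longlonglongrightarrow> 0"
    have "\<forall>\<^sub>F n in sequentially. real (d n) / sqrt (real n) < 1"
      using lim by (rule order_tendstoD) simp
    then show "\<forall>\<^sub>F n in sequentially. even n \<longrightarrow>
        (\<exists>\<A>. \<A> \<subseteq> layer n (n div 2) \<and> pattern_free (IP (d n)) \<A> \<and>
           real (card \<A>) \<ge>
             1 / 3 * max (1 / (real n * real (d n))) (real (d n) ^ 2 / real n powr (3 / 2))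
               * real (n choose (n div 2)))"
      using eventually_gt_at_top[of 0]
    proof eventually_elim
      case (elim n)
      define D where "D = d n"
      define s where "s = sqrt (real n)"
      have D: "0 < D" and s: "0 < s" "s\<^sup>2 = real n" and Ds: "real D < s"
        using pos elim by (simp_all add: D_def s_def)
      have D1: "1 \<le> real D"
        using D by simp
      \<comment> \<open>Since \<open>1 \<le> D < s\<close>, also
        \<open>s \<le> s\<^sup>2 = n\<close>, whence \<open>D \<le> n\<close>.\<close>
      have "s * 1 \<le> s * s"
        using D1 Ds by (intro mult_left_mono) auto
      then have "real D \<le> real n"
        using Ds unfolding s(2)[symmetric] power2_eq_square by linarith
      then obtain \<A> where A: "\<A> \<subseteq> layer n (n div 2)" "pattern_free (IP D) \<A>"
        "real (card \<A>) \<ge> real D / (3 * real n) * real (n choose (n div 2))"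
        using IP_free_large_sum_class[OF D, of n "n div 2"] by auto
      have "real n powr (3 / 2) = s ^ 3"
      proof -
        have "real n powr (3 / 2) = (real n powr (1 / 2)) powr 3"
          by (simp add: powr_powr)
        then show ?thesis
          using s(1) by (simp add: powr_half_sqrt s_def)
      qed
      \<comment> \<open>Splitting off \<open>D / s < 1\<close> leaves \<open>D / n\<close>, which
        bounds the other term of the maximum too.\<close>
      then have "(real D)\<^sup>2 / real n powr (3 / 2) = real D / real n * (real D / s)"
        by (simp add: power2_eq_square power3_eq_cube flip: s(2))
      also have "\<dots> \<le> real D / real n * 1"
        using Ds s(1) by (intro mult_left_mono) auto
      finally have b2: "(real D)\<^sup>2 / real n powr (3 / 2) \<le> real D / real n"
        by simp
      have "1 \<le> real D * real D"
        using D1 mult_mono[of 1 "real D" 1 "real D"] by simp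
      then have b1: "1 / (real n * real D) \<le> real D / real n"
        using D elim(2) by (simp add: field_simps)
      have "1 / 3 * max (1 / (real n * real D)) ((real D)\<^sup>2 / real n powr (3 / 2)) \<le> real D / (3 * real n)"
        using b1 b2 by simp
      then have "1 / 3 * max (1 / (real n * real D)) ((real D)\<^sup>2 / real n powr (3 / 2)) *
          real (n choose (n div 2)) \<le> real D / (3 * real n) * real (n choose (n div 2))"
        by (rule mult_right_mono) simp
      then show ?case
        using A unfolding D_def by (meson order_trans)
    qed
  qed simp
next
  fix c :: real
  assume c: "c > 0"
  \<comment> \<open>\<open>c1\<close> serves \<open>d < 4\<close>, where
    \<open>n \<le> 16 / c\<^sup>2\<close> and the binomial is at most \<open>2 ^ n\<close>;
    \<open>c2\<close> serves \<open>d \<ge> 4\<close>.\<close>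
  define c1 where "c1 = 2 powr (- (16 / c\<^sup>2))"
  define c2 where "c2 = exp (- pi\<^sup>2 / c\<^sup>2) / c"
  show "\<exists>c'::real. c' > 0 \<and>
         (\<forall>n d :: nat. even n \<longrightarrow> d > 0 \<longrightarrow> real d = c * sqrt (real n) \<longrightarrow>
            (\<exists>\<A>. \<A> \<subseteq> layer n (n div 2) \<and> pattern_free (IP d) \<A> \<and>
               real (card \<A>) \<ge> c' * real (n choose (n div 2))))"
  proof (intro exI[of _ "min c1 c2"] conjI allI impI)
    show "min c1 c2 > 0"
      using c by (simp add: c1_def c2_def)
    fix n d :: nat
    assume "even n" and d: "d > 0" "real d = c * sqrt (real n)"
    then obtain k where n: "n = 2 * k"
      by blast
    have "\<exists>\<A>. \<A> \<subseteq> layer n k \<and> pattern_free (IP d) \<A> \<and>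
        (real (card \<A>) \<ge> c1 * real (n choose k) \<or> real (card \<A>) \<ge> c2 * real (n choose k))"
    proof (cases "d \<ge> 4")
      case True
      then show ?thesis
        using IP_free_family_sqrt_scale[OF c True, of k] d(2) unfolding n c2_def by metis
    next
      case False
      text \<open>Here \<open>n\<close> is bounded in terms of \<open>c\<close>, so a single set suffices.\<close>
      have "(real d)\<^sup>2 \<le> 4\<^sup>2"
        using False by (intro power_mono) auto
      then have "real n \<le> 16 / c\<^sup>2"
        using c unfolding d(2) by (simp add: power_mult_distrib field_simps)
      then have "2 powr real n \<le> 2 powr (16 / c\<^sup>2)"
        by simp
      moreover have "real (n choose k) \<le> 2 powr real n"
        using binomial_le_pow2[of n k]
        by (simp add: powr_realpow)
      ultimately have "real (n choose k) \<le> 2 powr (16 / c\<^sup>2)"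
        by (rule order_trans[rotated])
      then have "c1 * real (n choose k) \<le> 2 powr (- (16 / c\<^sup>2)) * 2 powr (16 / c\<^sup>2)"
        unfolding c1_def by (intro mult_left_mono) auto
      also have "\<dots> = 1"
        by (simp flip: powr_add)
      finally have "c1 * real (n choose k) \<le> real (card {{1..k}})"
        by simp
      moreover have "{{1..k}} \<subseteq> layer n k"
        by (simp add: layer_def n)
      moreover have "pattern_free (IP d) {{1..k}}"
        using IP_neq_Nil[OF d(1)] by (auto simp: pattern_free_def pat_refl)
      ultimately show ?thesis
        by blast
    qed
    then obtain \<A> where "\<A> \<subseteq> layer n k" "pattern_free (IP d) \<A>"
      and bound: "real (card \<A>) \<ge> c1 * real (n choose k) \<or> real (card \<A>) \<ge> c2 * real (n choose k)"
      by blast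
    moreover have "min c1 c2 * real (n choose k) \<le> real (card \<A>)"
      using bound mult_right_mono[of "min c1 c2" c1 "real (n choose k)"]
        mult_right_mono[of "min c1 c2" c2 "real (n choose k)"] by fastforce
    ultimately show "\<exists>\<A>. \<A> \<subseteq> layer n (n div 2) \<and> pattern_free (IP d) \<A> \<and>
        real (card \<A>) \<ge> min c1 c2 * real (n choose (n div 2))"
      using n by auto
  qed
qed

end
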